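(* Let $(E,\mathcal E,\mu)$ be a measure space and let $G\colon E\times E\to[0,\infty]$ be $\mathcal E\otimes\mathcal E$-measurable. If there is a strictly positive function in $\mathcal F_{co}(G)$, then $\mathcal F_{ui}(G)\subset\mathcal F_{co}(G)$.
   Context: $\mathcal E^+$ is the set of all $\mathcal E$-measurable functions $f\colon E\to[0,\infty]$. $\mathcal E_b$ is the space of all bounded $\mathcal E$-measurable functions $f\colon E\to\mathbb R$, equipped with the sup-norm $\|\cdot\|_\infty$. The convention $0\cdot\infty=0$ is used. A function $q$ on $E$ is strictly positive if $q(x)>0$ for every $x\in E$. For a measurable function $f$ on $E$ (for $f\in\mathcal E^+$, or whenever the integrals exist), $Gf(x):=\int G(x,y)f(y)\,d\mu(y)$, $x\in E$. For $q\in\mathcal E^+$ with $Gq$ bounded, $K_q$ denotes the map $f\mapsto G(fq)$ on $\mathcal E_b$, i.e. $K_qf(x)=\int G(x,y)f(y)q(y)\,d\mu(y)$. $\mathcal F_{co}(G)$ is the set of all $q\in\mathcal E^+$ such that $Gq$ is bounded and $K_q$ is a compact operator on $\mathcal E_b$ (in particular it maps $\mathcal E_b$ into $\mathcal E_b$). A subset $\mathcal F$ of $\mathcal E^+$ is called uniformly integrable if for every $\varepsilon>0$ there exists a $\mu$-integrable $g\in\mathcal E^+$ such that $\int_{\{f\ge g\}}f\,d\mu\le\varepsilon$ for every $f\in\mathcal F$. $\mathcal F_{ui}(G)$ is the set of all $q\in\mathcal E^+$ such that the family $\{G(x,\cdot)q\colon x\in E\}$ is uniformly integrable. *)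

theory Defs
  imports "HOL-Analysis.Analysis"
begin

definition Eplus :: "'a measure \<Rightarrow> ('a \<Rightarrow> ennreal) set" where
  "Eplus M = borel_measurable M"

text \<open>The space of bounded measurable real functions with the sup-metric
  \<open>SUP x\<in>space M. \<bar>f x - g x\<bar>\<close>, obtained as a subspace of the library's space of bounded
  functions on \<open>space M\<close>. Functions on \<open>space M\<close> are represented extensionally, that is, they
  are \<open>undefined\<close> outside \<open>space M\<close>.\<close>

definition Eb :: "'a measure \<Rightarrow> ('a \<Rightarrow> real) metric" where
  "Eb M = submetric (funspace (space M) euclidean_metric) (borel_measurable M)"

lemma in_mspace_Eb:
  "f \<in> mspace (Eb M) \<longleftrightarrow>
     f \<in> extensional (space M) \<and> f \<in> borel_measurable M \<and> bounded (f ` space M)"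
  by (auto simp: Eb_def Met_TC.fspace_def)

lemma mdist_Eb:
  assumes "space M \<noteq> {}" "f \<in> mspace (Eb M)" "g \<in> mspace (Eb M)"
  shows "mdist (Eb M) f g = (SUP x\<in>space M. \<bar>f x - g x\<bar>)"
  using assms by (simp add: Eb_def Met_TC.fdist_def dist_real_def)

definition linear_on_Eb :: "'a measure \<Rightarrow> (('a \<Rightarrow> real) \<Rightarrow> ('a \<Rightarrow> real)) \<Rightarrow> bool" where
  "linear_on_Eb M T \<longleftrightarrow>
     (\<forall>f\<in>mspace (Eb M). \<forall>g\<in>mspace (Eb M). \<forall>a b.
        T (\<lambda>x\<in>space M. a * f x + b * g x) = (\<lambda>x\<in>space M. a * T f x + b * T g x))"

text \<open>A compact operator is a linear map of the space into itself which sends the closed unit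
  ball to a relatively compact set.\<close>

definition compact_operator_Eb :: "'a measure \<Rightarrow> (('a \<Rightarrow> real) \<Rightarrow> ('a \<Rightarrow> real)) \<Rightarrow> bool" where
  "compact_operator_Eb M T \<longleftrightarrow>
     T ` mspace (Eb M) \<subseteq> mspace (Eb M) \<and>
     linear_on_Eb M T \<and>
     compactin (mtopology_of (Eb M))
       (mtopology_of (Eb M) closure_of (T ` mcball_of (Eb M) (\<lambda>x\<in>space M. 0) 1))"

definition potential ::
  "'a measure \<Rightarrow> ('a \<Rightarrow> 'a \<Rightarrow> ennreal) \<Rightarrow> ('a \<Rightarrow> ennreal) \<Rightarrow> 'a \<Rightarrow> ennreal" where
  "potential M G f x = (\<integral>\<^sup>+ y. G x y * f y \<partial>M)"

definition bounded_potential ::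
  "'a measure \<Rightarrow> ('a \<Rightarrow> 'a \<Rightarrow> ennreal) \<Rightarrow> ('a \<Rightarrow> ennreal) \<Rightarrow> bool" where
  "bounded_potential M G q \<longleftrightarrow> (\<exists>C::real. \<forall>x\<in>space M. potential M G q x \<le> ennreal C)"

text \<open>The operator \<open>f \<mapsto> G (f q)\<close>. The extended real function \<open>y \<mapsto> G x y * f y * q y\<close> is
  integrated as the integral of its positive part minus that of its negative part. Since
  \<open>ennreal\<close> sends negative reals to \<open>0\<close>, these parts are given by \<open>ennreal (f y)\<close> and
  \<open>ennreal (- f y)\<close>; both integrals are finite if \<open>f\<close> and the potential of \<open>q\<close> are bounded.
  Note that \<open>0 * \<infinity> = 0\<close> in \<open>ennreal\<close>.\<close>

definition K_op ::
  "'a measure \<Rightarrow> ('a \<Rightarrow> 'a \<Rightarrow> ennreal) \<Rightarrow> ('a \<Rightarrow> ennreal) \<Rightarrow> ('a \<Rightarrow> real) \<Rightarrow> ('a \<Rightarrow> real)" where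
  "K_op M G q f = (\<lambda>x\<in>space M.
     enn2real (potential M G (\<lambda>y. ennreal (f y) * q y) x)
     - enn2real (potential M G (\<lambda>y. ennreal (- f y) * q y) x))"

definition F_co :: "'a measure \<Rightarrow> ('a \<Rightarrow> 'a \<Rightarrow> ennreal) \<Rightarrow> ('a \<Rightarrow> ennreal) set" where
  "F_co M G = {q \<in> Eplus M. bounded_potential M G q \<and> compact_operator_Eb M (K_op M G q)}"

text \<open>Uniform integrability is meant in the following sense, and not in the one common in
  probability theory with constants in place of integrable functions \<open>g\<close>.\<close>

definition unif_integrable :: "'a measure \<Rightarrow> ('a \<Rightarrow> ennreal) set \<Rightarrow> bool" where
  "unif_integrable M F \<longleftrightarrow> F \<subseteq> Eplus M \<and>
     (\<forall>\<epsilon>::real. \<epsilon> > 0 \<longrightarrow>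
       (\<exists>g\<in>Eplus M. (\<integral>\<^sup>+ y. g y \<partial>M) < \<infinity> \<and>
         (\<forall>f\<in>F. (\<integral>\<^sup>+ y\<in>{y\<in>space M. f y \<ge> g y}. f y \<partial>M) \<le> ennreal \<epsilon>)))"

definition F_ui :: "'a measure \<Rightarrow> ('a \<Rightarrow> 'a \<Rightarrow> ennreal) \<Rightarrow> ('a \<Rightarrow> ennreal) set" where
  "F_ui M G = {q \<in> Eplus M. unif_integrable M {(\<lambda>y. G x y * q y) |x. x \<in> space M}}"

definition strictly_positive :: "'a measure \<Rightarrow> ('a \<Rightarrow> ennreal) \<Rightarrow> bool" where
  "strictly_positive M q \<longleftrightarrow> (\<forall>x\<in>space M. q x > 0)"

end

theory Submission
  imports Defs
begin

text \<open>Let \<open>q\<^sub>0 > 0\<close> be in \<open>F_co\<close>, let \<open>q\<close> be in \<open>F_ui\<close>, and cut \<open>q\<close> down to the set \<open>A\<^sub>n\<close> of points with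
  \<open>q \<le> n * q\<^sub>0\<close> and both functions finite. The truncated operator is \<open>K\<^sub>q\<^sub>0\<close> composed with the
  multiplication by the bounded function \<open>q / q\<^sub>0\<close> on \<open>A\<^sub>n\<close>, hence maps bounded sets to totally
  bounded ones. The points where \<open>q\<close> or \<open>q\<^sub>0\<close> is infinite are null for every measure
  \<open>G x y * q y * \<mu>(dy)\<close>, and the sets \<open>{n * q\<^sub>0 < q < \<infinity>}\<close> decrease to the empty set, so uniform
  integrability makes the truncations converge to \<open>K\<^sub>q\<close> in operator norm. This gives compactness as
  well as the measurability of \<open>K\<^sub>q f\<close>, for which Fubini is unavailable since \<open>\<mu>\<close> need not be
  \<open>\<sigma>\<close>-finite.\<close>

section \<open>Totally bounded sets in metric spaces\<close>

text \<open>A finite net of the approximating set also serves \<open>S\<close> with a larger radius,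
  but its centres need not lie in \<open>S\<close>, as \<open>mtotally_bounded\<close> demands. Each
  useful centre is therefore replaced by a nearby point of \<open>S\<close>. Radius \<epsilon>/5
  leaves room: points of \<open>S\<close> are within 2\<epsilon>/5 of a centre, hence within
  4\<epsilon>/5 of its replacement.\<close>

lemma (in Metric_space) mtotally_bounded_approx:
  assumes "S \<subseteq> M"
    and "\<And>\<epsilon>. 0 < \<epsilon> \<Longrightarrow> \<exists>T. mtotally_bounded T \<and> (\<forall>s\<in>S. \<exists>t\<in>T. d s t \<le> \<epsilon>)"
  shows "mtotally_bounded S"
  unfolding mtotally_bounded_def
proof (intro allI impI)
  fix \<epsilon> :: real assume "0 < \<epsilon>"
  then obtain T where T: "mtotally_bounded T" and close: "\<And>s. s \<in> S \<Longrightarrow> \<exists>t\<in>T. d s t \<le> \<epsilon>/5"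
    using assms(2)[of "\<epsilon>/5"] by auto
  have "T \<subseteq> M"
    using T by (rule mtotally_bounded_imp_subset)
  obtain K where K: "finite K" "K \<subseteq> T" "T \<subseteq> (\<Union>x\<in>K. mball x (\<epsilon>/5))"
    using T[unfolded mtotally_bounded_def, rule_format, of "\<epsilon>/5"] \<open>0 < \<epsilon>\<close> by auto
  \<comment> \<open>Centres far from \<open>S\<close> are discarded, since no replacement in
    \<open>S\<close> could be chosen for them.\<close>
  define K' where "K' = {k\<in>K. \<exists>s\<in>S. d s k < 2*\<epsilon>/5}"
  have "\<forall>k\<in>K'. \<exists>s\<in>S. d s k < 2*\<epsilon>/5"
    by (simp add: K'_def)
  then obtain h where h: "\<And>k. k \<in> K' \<Longrightarrow> h k \<in> S \<and> d (h k) k < 2*\<epsilon>/5"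
    by metis
  show "\<exists>K. finite K \<and> K \<subseteq> S \<and> S \<subseteq> (\<Union>x\<in>K. mball x \<epsilon>)"
  proof (intro exI conjI subsetI)
    show "finite (h ` K')"
      using K(1) by (simp add: K'_def)
    show "s \<in> S" if "s \<in> h ` K'" for s
      using that h by auto
    show "s \<in> (\<Union>x\<in>h ` K'. mball x \<epsilon>)" if s: "s \<in> S" for s
    proof -
      obtain t where t: "t \<in> T" "d s t \<le> \<epsilon>/5"
        using close s by blast
      obtain k where k: "k \<in> K" "d k t < \<epsilon>/5"
        using K(3) t by (auto simp: subset_iff)
      have M: "s \<in> M" "t \<in> M" "k \<in> M"
        using s t k K(2) \<open>T \<subseteq> M\<close> assms(1) by auto
      have sk: "d s k < 2*\<epsilon>/5"
        using triangle[of s t k] M t(2) k(2) commute[of k t] by linarith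
      then have "k \<in> K'"
        using k(1) s by (auto simp: K'_def)
      with h have hk: "h k \<in> S" "d (h k) k < 2*\<epsilon>/5"
        by auto
      then have "h k \<in> M"
        using assms(1) by blast
      have "d (h k) s < \<epsilon>"
        using triangle[of "h k" k s] M \<open>h k \<in> M\<close> hk(2) sk commute[of s k] \<open>0 < \<epsilon>\<close> by linarith
      then show ?thesis
        using \<open>k \<in> K'\<close> \<open>h k \<in> M\<close> M(1) by (auto simp: in_mball)
    qed
  qed
qed

section \<open>The sup-metric space of bounded measurable functions\<close>

text \<open>The hypothesis \<open>0 \<le> r\<close> serves the case of an empty
  \<open>space M\<close>, where the distance is 0 and the pointwise bound says nothing about
  \<open>r\<close>.\<close>

lemma mdist_Eb_le:
  assumes "f \<in> mspace (Eb M)" "g \<in> mspace (Eb M)" "0 \<le> r"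
    and "\<And>x. x \<in> space M \<Longrightarrow> \<bar>f x - g x\<bar> \<le> r"
  shows "mdist (Eb M) f g \<le> r"
proof (cases "space M = {}")
  case True
  then show ?thesis
    using assms(3) by (simp add: Eb_def)
next
  case False
  then show ?thesis
    using assms by (auto simp: mdist_Eb intro: cSUP_least)
qed

lemma abs_diff_le_mdist_Eb:
  assumes f: "f \<in> mspace (Eb M)" and g: "g \<in> mspace (Eb M)" and x: "x \<in> space M"
  shows "\<bar>f x - g x\<bar> \<le> mdist (Eb M) f g"
proof -
  have "f \<in> mspace (funspace (space M) euclidean_metric)"
    "g \<in> mspace (funspace (space M) euclidean_metric)"
    using f g by (auto simp: Eb_def)
  from funspace_mdist_le[OF this, of "mdist (Eb M) f g"] x show ?thesis
    by (auto simp: Eb_def dist_real_def)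
qed

lemma mspace_EbE:
  assumes "f \<in> mspace (Eb M)"
  obtains C where "0 \<le> C" "\<And>x. x \<in> space M \<Longrightarrow> \<bar>f x\<bar> \<le> C"
proof -
  have "bounded (f ` space M)"
    using assms by (simp add: in_mspace_Eb)
  then obtain C where "\<forall>y\<in>f ` space M. norm y \<le> C"
    by (auto simp: bounded_iff)
  then have "\<bar>f x\<bar> \<le> max C 0" if "x \<in> space M" for x
    using that by (auto simp: le_max_iff_disj)
  then show ?thesis
    using that[of "max C 0"] by auto
qed

lemma mspace_EbI:
  fixes f :: "'a \<Rightarrow> real"
  assumes "f \<in> borel_measurable M" "\<And>x. x \<in> space M \<Longrightarrow> \<bar>f x\<bar> \<le> C"
  shows "(\<lambda>x\<in>space M. f x) \<in> mspace (Eb M)"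
proof -
  have "(\<lambda>x\<in>space M. f x) \<in> borel_measurable M"
    using assms(1) by (subst measurable_cong[where g = f]) auto
  moreover have "bounded ((\<lambda>x\<in>space M. f x) ` space M)"
    using assms(2) by (auto simp: bounded_iff)
  ultimately show ?thesis
    by (simp add: in_mspace_Eb)
qed

text \<open>Measurability passes to pointwise limits and boundedness to uniform ones. This serves
  twice: for the completeness of \<open>Eb M\<close>, and later to show that
  \<open>K_op M G q\<close> maps \<open>Eb M\<close> into itself.\<close>

lemma mspace_Eb_uniform_limit:
  assumes ext: "f \<in> extensional (space M)"
    and approx: "\<And>\<epsilon>. 0 < \<epsilon> \<Longrightarrow> \<exists>g\<in>mspace (Eb M). \<forall>x\<in>space M. \<bar>f x - g x\<bar> \<le> \<epsilon>"
  shows "f \<in> mspace (Eb M)"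
proof -
  have "\<forall>n. \<exists>g\<in>mspace (Eb M). \<forall>x\<in>space M. \<bar>f x - g x\<bar> \<le> 1 / real (Suc n)"
    using approx by simp
  then obtain g where g: "\<And>n. g n \<in> mspace (Eb M)"
    "\<And>n x. x \<in> space M \<Longrightarrow> \<bar>f x - g n x\<bar> \<le> 1 / real (Suc n)"
    by metis
  have "f \<in> borel_measurable M"
  proof (rule borel_measurable_LIMSEQ_real)
    show "g n \<in> borel_measurable M" for n
      using g(1) by (simp add: in_mspace_Eb)
    show "(\<lambda>n. g n x) \<longlonglongrightarrow> f x" if "x \<in> space M" for x
    proof (rule LIMSEQ_I)
      fix r :: real assume "0 < r"
      then obtain N where N: "1 / real (Suc N) < r"
        by (metis nat_approx_posE)
      have "norm (g n x - f x) < r" if "N \<le> n" for n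
      proof -
        have "norm (g n x - f x) \<le> 1 / real (Suc n)"
          using g(2)[OF \<open>x \<in> space M\<close>, of n] by (simp add: abs_minus_commute)
        also have "\<dots> \<le> 1 / real (Suc N)"
          using that by (simp add: frac_le)
        finally show ?thesis
          using N by simp
      qed
      then show "\<exists>N. \<forall>n\<ge>N. norm (g n x - f x) < r"
        by blast
    qed
  qed
  moreover obtain C where C: "\<And>x. x \<in> space M \<Longrightarrow> \<bar>g 0 x\<bar> \<le> C"
    using mspace_EbE[OF g(1)] by blast
  \<comment> \<open>The summand 1 is the error \<open>1 / real (Suc 0)\<close> of the first
    approximant.\<close>
  have "\<bar>f x\<bar> \<le> C + 1" if "x \<in> space M" for x
    using g(2)[OF that, of 0] C[OF that] by simp
  ultimately have "(\<lambda>x\<in>space M. f x) \<in> mspace (Eb M)"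
    by (rule mspace_EbI)
  then show ?thesis
    using ext by (simp add: extensional_restrict)
qed

text \<open>Bounded functions into the complete space of reals form a complete space, and the
  measurable ones are sequentially closed in it, because convergence there is uniform.\<close>

lemma mcomplete_Eb: "Metric_space.mcomplete (mspace (Eb M)) (mdist (Eb M))"
proof -
  let ?F = "funspace (space M) (euclidean_metric :: real metric)"
  interpret F: Metric_space "mspace ?F" "mdist ?F"
    by (rule Metric_space_mspace_mdist)
  interpret S: Submetric "mspace ?F" "mdist ?F" "mspace (Eb M)"
    by unfold_locales (simp add: Eb_def)
  have "Met_TC.mcomplete (TYPE(real))"
    by (simp add: complete_UNIV)
  then have "F.mcomplete"
    using Met_TC.mcomplete_funspace[where 'a = real, of "space M"]
    by (simp add: mcomplete_of_def euclidean_metric_def)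
  then have "S.sub.mcomplete"
  proof (rule S.sequentially_closedin_mcomplete_imp_mcomplete)
    fix \<sigma> l assume A: "range \<sigma> \<subseteq> mspace (Eb M) \<and> limitin F.mtopology \<sigma> l sequentially"
    then have l: "l \<in> mspace ?F"
      and lim: "\<And>\<epsilon>. 0 < \<epsilon> \<Longrightarrow> \<exists>N. \<forall>n\<ge>N. \<sigma> n \<in> mspace ?F \<and> mdist ?F (\<sigma> n) l < \<epsilon>"
      unfolding F.limit_metric_sequentially by blast+
    show "l \<in> mspace (Eb M)"
    proof (rule mspace_Eb_uniform_limit)
      show "l \<in> extensional (space M)"
        using l by (rule funspace_imp_extensional)
      fix \<epsilon> :: real assume "0 < \<epsilon>"
      then obtain n where n: "\<sigma> n \<in> mspace ?F" "mdist ?F (\<sigma> n) l < \<epsilon>"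
        using lim by blast
      have "\<bar>l x - \<sigma> n x\<bar> \<le> \<epsilon>" if "x \<in> space M" for x
      proof -
        have "dist (\<sigma> n x) (l x) \<le> \<epsilon>"
          using funspace_mdist_le[OF n(1) l, of \<epsilon>] n(2) that by auto
        then show ?thesis
          by (simp add: dist_real_def abs_minus_commute)
      qed
      then show "\<exists>g\<in>mspace (Eb M). \<forall>x\<in>space M. \<bar>l x - g x\<bar> \<le> \<epsilon>"
        using A by blast
    qed
  qed
  then show ?thesis
    by (simp add: Eb_def)
qed

lemma mspace_Eb_mult:
  fixes m :: "'a \<Rightarrow> real"
  assumes f: "f \<in> mspace (Eb M)" and m: "m \<in> borel_measurable M" "\<And>x. x \<in> space M \<Longrightarrow> \<bar>m x\<bar> \<le> B"
  shows "(\<lambda>x\<in>space M. m x * f x) \<in> mspace (Eb M)"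
proof -
  obtain C where "\<And>x. x \<in> space M \<Longrightarrow> \<bar>f x\<bar> \<le> C"
    using mspace_EbE[OF f] by blast
  then have "\<bar>m x * f x\<bar> \<le> B * C" if "x \<in> space M" for x
    unfolding abs_mult using that m(2)[OF that] by (intro mult_mono) auto
  moreover have "(\<lambda>x. m x * f x) \<in> borel_measurable M"
    using f m(1) by (intro borel_measurable_times) (auto simp: in_mspace_Eb)
  ultimately show ?thesis
    by (intro mspace_EbI)
qed

lemma mspace_Eb_scale:
  "f \<in> mspace (Eb M) \<Longrightarrow> (\<lambda>x\<in>space M. c * f x) \<in> mspace (Eb M)" for c :: real
  by (rule mspace_Eb_mult) auto

text \<open>Scaling is Lipschitz with constant \<open>c\<close>, and Lipschitz maps preserve total
  boundedness. It is needed because the approximating operators are multiples of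
  \<open>K_op M G q0\<close> applied to functions in the unit ball.\<close>

lemma mtotally_bounded_Eb_scale:
  assumes "Metric_space.mtotally_bounded (mspace (Eb M)) (mdist (Eb M)) S" "0 \<le> c"
  shows "Metric_space.mtotally_bounded (mspace (Eb M)) (mdist (Eb M))
    ((\<lambda>f. \<lambda>x\<in>space M. c * f x) ` S)"
proof -
  interpret E: Metric_space "mspace (Eb M)" "mdist (Eb M)"
    by (rule Metric_space_mspace_mdist)
  let ?s = "\<lambda>f. \<lambda>x\<in>space M. c * f x"
  note sE = mspace_Eb_scale[of _ M c]
  have dist: "mdist (Eb M) (?s f) (?s g) \<le> c * mdist (Eb M) f g"
    if f: "f \<in> mspace (Eb M)" and g: "g \<in> mspace (Eb M)" for f g
  proof (rule mdist_Eb_le[OF sE[OF f] sE[OF g]])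
    show "0 \<le> c * mdist (Eb M) f g"
      using assms(2) by simp
    fix x assume x: "x \<in> space M"
    have "\<bar>?s f x - ?s g x\<bar> = c * \<bar>f x - g x\<bar>"
      using x assms(2) by (simp add: abs_mult flip: right_diff_distrib)
    also have "\<dots> \<le> c * mdist (Eb M) f g"
      using abs_diff_le_mdist_Eb[OF f g x] assms(2) by (rule mult_left_mono)
    finally show "\<bar>?s f x - ?s g x\<bar> \<le> c * mdist (Eb M) f g" .
  qed
  have "Lipschitz_continuous_map (Eb M) (Eb M) ?s"
    unfolding Lipschitz_continuous_map_def using sE dist by blast
  then show ?thesis
    using assms(1) mtotally_bounded_Cauchy_continuous_image Lipschitz_imp_Cauchy_continuous_map
    by blast
qed

section \<open>Compact operators through total boundedness\<close>

text \<open>In a complete metric space a subset has compact closure exactly if it is totally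
  bounded; the latter notion is the one that survives approximation in operator norm.\<close>

lemma compact_operator_Eb_iff_mtotally_bounded:
  "compact_operator_Eb M T \<longleftrightarrow>
     T ` mspace (Eb M) \<subseteq> mspace (Eb M) \<and> linear_on_Eb M T \<and>
     Metric_space.mtotally_bounded (mspace (Eb M)) (mdist (Eb M))
       (T ` mcball_of (Eb M) (\<lambda>x\<in>space M. 0) 1)"
proof -
  interpret E: Metric_space "mspace (Eb M)" "mdist (Eb M)"
    by (rule Metric_space_mspace_mdist)
  show ?thesis
    unfolding compact_operator_Eb_def mtopology_of_def
      E.mtotally_bounded_eq_compact_closure_of[OF mcomplete_Eb]
    by auto
qed

lemma F_co_iff_mtotally_bounded:
  "q \<in> F_co M G \<longleftrightarrow>
     q \<in> borel_measurable M \<and> bounded_potential M G q \<and>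
     K_op M G q ` mspace (Eb M) \<subseteq> mspace (Eb M) \<and> linear_on_Eb M (K_op M G q) \<and>
     Metric_space.mtotally_bounded (mspace (Eb M)) (mdist (Eb M))
       (K_op M G q ` mcball_of (Eb M) (\<lambda>x\<in>space M. 0) 1)"
  by (simp add: F_co_def Eplus_def compact_operator_Eb_iff_mtotally_bounded)

lemma F_ui_imp_measurable: "q \<in> F_ui M G \<Longrightarrow> q \<in> borel_measurable M"
  by (simp add: F_ui_def Eplus_def)

section \<open>The operator as a Bochner integral\<close>

text \<open>A real density makes the Bochner integral and its linearity available. Infinite values
  of the product become 0; for a bounded potential this changes the product only on a null set,
  which may depend on \<open>x\<close>.\<close>

definition weighted_kernel ::
  "('a \<Rightarrow> 'a \<Rightarrow> ennreal) \<Rightarrow> ('a \<Rightarrow> ennreal) \<Rightarrow> 'a \<Rightarrow> 'a \<Rightarrow> real" where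
  "weighted_kernel G q x y = enn2real (G x y * q y)"

lemma weighted_kernel_nonneg [simp]: "0 \<le> weighted_kernel G q x y"
  by (simp add: weighted_kernel_def)

context
  fixes M :: "'a measure" and G :: "'a \<Rightarrow> 'a \<Rightarrow> ennreal"
  assumes G: "(\<lambda>(x, y). G x y) \<in> borel_measurable (M \<Otimes>\<^sub>M M)"
begin

lemma measurable_section [measurable]: "x \<in> space M \<Longrightarrow> G x \<in> borel_measurable M"
  using measurable_Pair2[OF G] by simp

context
  fixes q :: "'a \<Rightarrow> ennreal"
  assumes q [measurable]: "q \<in> borel_measurable M"
    and bp: "bounded_potential M G q"
begin

lemma AE_potential_finite:
  assumes [measurable]: "x \<in> space M"
  shows "AE y in M. G x y * q y \<noteq> \<infinity>"
proof (rule nn_integral_PInf_AE)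
  show "(\<lambda>y. G x y * q y) \<in> borel_measurable M"
    by measurable
  show "(\<integral>\<^sup>+ y. G x y * q y \<partial>M) \<noteq> \<infinity>"
    using bp assms unfolding bounded_potential_def potential_def
    by (metis ennreal_less_top infinity_ennreal_def leD less_top)
qed

lemma AE_weighted_kernel:
  assumes "x \<in> space M"
  shows "AE y in M. ennreal (weighted_kernel G q x y) = G x y * q y"
  using AE_potential_finite[OF assms] by eventually_elim (simp add: weighted_kernel_def less_top)

lemma integrable_weighted_kernel:
  assumes x [measurable]: "x \<in> space M"
  shows "integrable M (weighted_kernel G q x)"
proof (rule integrableI_nonneg)
  show "weighted_kernel G q x \<in> borel_measurable M"
    unfolding weighted_kernel_def by measurable
  have "(\<integral>\<^sup>+ y. ennreal (weighted_kernel G q x y) \<partial>M) = potential M G q x"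
    unfolding potential_def using AE_weighted_kernel[OF x] by (rule nn_integral_cong_AE)
  then show "(\<integral>\<^sup>+ y. ennreal (weighted_kernel G q x y) \<partial>M) < \<infinity>"
    using bp x unfolding bounded_potential_def
    by (metis ennreal_less_top infinity_ennreal_def le_less_trans)
qed simp

lemma integrable_mult_weighted_kernel:
  assumes f: "f \<in> mspace (Eb M)" and x: "x \<in> space M"
  shows "integrable M (\<lambda>y. f y * weighted_kernel G q x y)"
proof -
  obtain C where C: "\<And>x. x \<in> space M \<Longrightarrow> \<bar>f x\<bar> \<le> C"
    using mspace_EbE[OF f] by blast
  show ?thesis
  proof (rule Bochner_Integration.integrable_bound)
    show "integrable M (\<lambda>y. C * weighted_kernel G q x y)"
      using integrable_weighted_kernel[OF x] by simp
    show "(\<lambda>y. f y * weighted_kernel G q x y) \<in> borel_measurable M"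
      using f integrable_weighted_kernel[OF x] by (auto simp: in_mspace_Eb)
    show "AE y in M. norm (f y * weighted_kernel G q x y) \<le> norm (C * weighted_kernel G q x y)"
      using C by (intro AE_I2) (force simp: abs_mult intro!: mult_right_mono)
  qed
qed

lemma K_op_eq_integral:
  assumes f: "f \<in> mspace (Eb M)" and x: "x \<in> space M"
  shows "K_op M G q f x = (\<integral>y. f y * weighted_kernel G q x y \<partial>M)"
proof -
  \<comment> \<open>No sign condition on \<open>h\<close> is imposed: since the kernel is
    nonnegative, \<open>ennreal\<close> cuts off negative values of \<open>h y\<close> in the same
    way on both sides. Taking \<open>h\<close> to be \<open>f\<close> and its negative yields the
    two parts in \<open>K_op\<close>.\<close>
  have "(\<integral>\<^sup>+ y. ennreal (h y * weighted_kernel G q x y) \<partial>M) = potential M G (\<lambda>y. ennreal (h y) * q y) x" for h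
    unfolding potential_def
  proof (rule nn_integral_cong_AE)
    show "AE y in M. ennreal (h y * weighted_kernel G q x y) = G x y * (ennreal (h y) * q y)"
      using AE_weighted_kernel[OF x]
      by eventually_elim (simp add: ennreal_mult'' mult.left_commute)
  qed
  from this[of f] this[of "\<lambda>y. - f y"] show ?thesis
    using x by (simp add: real_lebesgue_integral_def[OF integrable_mult_weighted_kernel[OF f x]] K_op_def)
qed

text \<open>Neither of the two potentials in \<open>K_op\<close> is linear in \<open>f\<close> by
  itself, so linearity is read off from the Bochner integral representation.\<close>

lemma linear_on_Eb_K_op: "linear_on_Eb M (K_op M G q)"
  unfolding linear_on_Eb_def
proof (intro ballI allI ext)
  fix f g a b x
  assume f: "f \<in> mspace (Eb M)" and g: "g \<in> mspace (Eb M)"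
  obtain C D where CD: "\<And>x. x \<in> space M \<Longrightarrow> \<bar>f x\<bar> \<le> C" "\<And>x. x \<in> space M \<Longrightarrow> \<bar>g x\<bar> \<le> D"
    using mspace_EbE[OF f] mspace_EbE[OF g] by metis
  have h: "(\<lambda>x\<in>space M. a * f x + b * g x) \<in> mspace (Eb M)"
  proof (rule mspace_EbI)
    show "(\<lambda>x. a * f x + b * g x) \<in> borel_measurable M"
      using f g by (auto simp: in_mspace_Eb)
    show "\<bar>a * f x + b * g x\<bar> \<le> \<bar>a\<bar> * C + \<bar>b\<bar> * D" if "x \<in> space M" for x
      using CD[OF that]
      by (intro order_trans[OF abs_triangle_ineq] add_mono) (auto simp: abs_mult mult_left_mono)
  qed
  show "K_op M G q (\<lambda>x\<in>space M. a * f x + b * g x) x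
      = (\<lambda>x\<in>space M. a * K_op M G q f x + b * K_op M G q g x) x"
  proof (cases "x \<in> space M")
    case True
    have "K_op M G q (\<lambda>x\<in>space M. a * f x + b * g x) x
        = (\<integral>y. a * (f y * weighted_kernel G q x y) + b * (g y * weighted_kernel G q x y) \<partial>M)"
      unfolding K_op_eq_integral[OF h True]
      by (intro Bochner_Integration.integral_cong) (auto simp: algebra_simps)
    also have "\<dots> = a * K_op M G q f x + b * K_op M G q g x"
      using integrable_mult_weighted_kernel[OF f True] integrable_mult_weighted_kernel[OF g True]
      by (simp add: K_op_eq_integral[OF f True] K_op_eq_integral[OF g True])
    finally show ?thesis
      using True by simp
  qed (simp add: K_op_def)
qed

end

section \<open>Consequences of uniform integrability\<close>

text \<open>Where \<open>G x y * q y\<close> is at least \<open>g y\<close>, its integral is at most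
  \<epsilon>; elsewhere it is below \<open>g y\<close>. One integrable \<open>g\<close> thus
  controls the integrals over every set \<open>B\<close>, uniformly in \<open>x\<close>.\<close>

lemma F_uiE:
  fixes \<epsilon> :: real
  assumes "q \<in> F_ui M G" "0 < \<epsilon>"
  obtains g where "g \<in> borel_measurable M" "(\<integral>\<^sup>+ y. g y \<partial>M) < \<infinity>"
    "\<And>x B. x \<in> space M \<Longrightarrow> B \<in> sets M \<Longrightarrow>
      (\<integral>\<^sup>+ y\<in>B. G x y * q y \<partial>M) \<le> ennreal \<epsilon> + (\<integral>\<^sup>+ y\<in>B. g y \<partial>M)"
proof -
  let ?U = "\<lambda>g x. {y\<in>space M. G x y * q y \<ge> g y}"
  have [measurable]: "q \<in> borel_measurable M"
    using assms(1) by (rule F_ui_imp_measurable)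
  obtain g where [measurable]: "g \<in> borel_measurable M" and g: "(\<integral>\<^sup>+ y. g y \<partial>M) < \<infinity>"
    and gq: "\<forall>f\<in>{(\<lambda>y. G x y * q y) |x. x \<in> space M}.
      (\<integral>\<^sup>+ y\<in>{y\<in>space M. f y \<ge> g y}. f y \<partial>M) \<le> ennreal \<epsilon>"
    using assms unfolding F_ui_def unif_integrable_def Eplus_def by blast
  have "(\<integral>\<^sup>+ y\<in>B. G x y * q y \<partial>M) \<le> ennreal \<epsilon> + (\<integral>\<^sup>+ y\<in>B. g y \<partial>M)"
    if [measurable]: "x \<in> space M" "B \<in> sets M" for x B
  proof -
    have "(\<integral>\<^sup>+ y\<in>B. G x y * q y \<partial>M)
        \<le> (\<integral>\<^sup>+ y. G x y * q y * indicator (?U g x) y + g y * indicator B y \<partial>M)"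
      by (intro nn_integral_mono) (auto simp: indicator_def)
    also have "\<dots> = (\<integral>\<^sup>+ y\<in>?U g x. G x y * q y \<partial>M) + (\<integral>\<^sup>+ y\<in>B. g y \<partial>M)"
      by (rule nn_integral_add) measurable
    also have "\<dots> \<le> ennreal \<epsilon> + (\<integral>\<^sup>+ y\<in>B. g y \<partial>M)"
      using gq \<open>x \<in> space M\<close> by (intro add_right_mono) auto
    finally show ?thesis .
  qed
  with g show ?thesis
    by (intro that[of g]) auto
qed

text \<open>With \<epsilon> = 1 and \<open>B\<close> the whole space, the preceding bound is a
  finite constant independent of \<open>x\<close>.\<close>

lemma F_ui_imp_bounded_potential:
  assumes q: "q \<in> F_ui M G"
  shows "bounded_potential M G q"
proof -
  obtain g where "g \<in> borel_measurable M" and g: "(\<integral>\<^sup>+ y. g y \<partial>M) < \<infinity>"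
    and gq: "\<And>x B. x \<in> space M \<Longrightarrow> B \<in> sets M \<Longrightarrow>
      (\<integral>\<^sup>+ y\<in>B. G x y * q y \<partial>M) \<le> ennreal 1 + (\<integral>\<^sup>+ y\<in>B. g y \<partial>M)"
    by (rule F_uiE[OF q zero_less_one]) blast
  have "potential M G q x \<le> ennreal (1 + enn2real (\<integral>\<^sup>+ y. g y \<partial>M))" if "x \<in> space M" for x
  proof -
    have "potential M G q x = (\<integral>\<^sup>+ y\<in>space M. G x y * q y \<partial>M)"
      unfolding potential_def by (intro nn_integral_cong) simp
    also have "\<dots> \<le> ennreal 1 + (\<integral>\<^sup>+ y\<in>space M. g y \<partial>M)"
      by (rule gq[OF that]) simp
    also have "(\<integral>\<^sup>+ y\<in>space M. g y \<partial>M) = (\<integral>\<^sup>+ y. g y \<partial>M)"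
      by (intro nn_integral_cong) simp
    finally show ?thesis
      using g by (simp add: ennreal_plus less_top del: ennreal_1)
  qed
  then show ?thesis
    unfolding bounded_potential_def by blast
qed

section \<open>Approximation in operator norm\<close>

text \<open>On a set \<open>A\<close> where \<open>q\<close> is at most a multiple of
  \<open>q0\<close> and both are finite, \<open>q\<close> equals \<open>q0\<close> times a bounded
  function, so the kernels agree there. What remains is an integral over a set \<open>B n\<close>,
  small uniformly in \<open>x\<close>: half of \<epsilon> comes from uniform integrability and half
  from \<open>g\<close> on \<open>B n\<close>.\<close>

lemma ex_weighted_kernel_approx:
  fixes \<epsilon> :: real
  assumes q0: "q0 \<in> borel_measurable M" "bounded_potential M G q0" "strictly_positive M q0"
    and q: "q \<in> F_ui M G" and "0 < \<epsilon>"
  obtains c :: real and m :: "'a \<Rightarrow> real"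
  where "0 < c" "m \<in> borel_measurable M" "\<And>y. \<bar>m y\<bar> \<le> 1"
    "\<And>x. x \<in> space M \<Longrightarrow>
      (\<integral>\<^sup>+ y. ennreal \<bar>weighted_kernel G q x y - c * (m y * weighted_kernel G q0 x y)\<bar> \<partial>M)
        \<le> ennreal \<epsilon>"
proof -
  note [measurable] = q0(1)
  have [measurable]: "q \<in> borel_measurable M"
    using q by (rule F_ui_imp_measurable)
  obtain g where [measurable]: "g \<in> borel_measurable M" and g: "(\<integral>\<^sup>+ y. g y \<partial>M) < \<infinity>"
    and gq: "\<And>x B. x \<in> space M \<Longrightarrow> B \<in> sets M \<Longrightarrow>
      (\<integral>\<^sup>+ y\<in>B. G x y * q y \<partial>M) \<le> ennreal (\<epsilon>/2) + (\<integral>\<^sup>+ y\<in>B. g y \<partial>M)"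
    by (rule F_uiE[OF q half_gt_zero[OF \<open>0 < \<epsilon>\<close>]]) blast
  \<comment> \<open>\<open>Suc n\<close> in place of \<open>n\<close> keeps the factor nonzero, so
    that points with \<open>q0 y = \<infinity>\<close> lie in no \<open>B n\<close>. The condition
    \<open>q y < \<infinity>\<close> removes the points at which \<open>q\<close> exceeds every
    finite multiple of \<open>q0\<close>.\<close>
  define B where "B n = {y\<in>space M. of_nat (Suc n) * q0 y < q y \<and> q y < \<infinity>}" for n
  have B [measurable]: "B n \<in> sets M" for n
    unfolding B_def by measurable
  have "(\<lambda>n. \<integral>\<^sup>+ y\<in>B n. g y \<partial>M) \<longlonglongrightarrow> (\<integral>\<^sup>+ y. 0 \<partial>M)"
  proof (rule nn_integral_dominated_convergence[OF _ _ _ _ g])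
    show "AE y in M. (\<lambda>n. g y * indicator (B n) y) \<longlonglongrightarrow> 0"
    proof (rule AE_I2)
      fix y assume y: "y \<in> space M"
      \<comment> \<open>Strict positivity enters here: where both values are finite, the multiples
        of \<open>q0 y\<close> eventually exceed \<open>q y\<close>. So the integrands vanish
        eventually, and \<open>g\<close> itself dominates them.\<close>
      have "\<exists>N. \<forall>n\<ge>N. y \<notin> B n"
      proof (cases "q y = \<infinity> \<or> q0 y = \<infinity>")
        case True
        then show ?thesis
          by (auto simp: B_def ennreal_mult_top)
      next
        case False
        then obtain a b where a: "q y = ennreal a" "0 \<le> a" and b: "q0 y = ennreal b" "0 \<le> b"
          by (metis ennreal_cases infinity_ennreal_def)
        have "0 < b"
          using q0(3) y b unfolding strictly_positive_def by fastforce
        then obtain N where N: "a < real N * b"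
          using reals_Archimedean3 by blast
        have "q y \<le> of_nat (Suc n) * q0 y" if "N \<le> n" for n
        proof -
          have "a \<le> real (Suc n) * b"
            using N that \<open>0 < b\<close> mult_right_mono[of "real N" "real (Suc n)" b] by linarith
          then show ?thesis
            using a b
            by (simp add: ennreal_of_nat_eq_real_of_nat del: of_nat_Suc flip: ennreal_mult)
        qed
        then show ?thesis
          unfolding B_def by (metis (no_types, lifting) leD mem_Collect_eq)
      qed
      then have "\<forall>\<^sub>F n in sequentially. g y * indicator (B n) y = 0"
        unfolding eventually_sequentially by (fastforce simp: indicator_def)
      then show "(\<lambda>n. g y * indicator (B n) y) \<longlonglongrightarrow> 0"
        by (rule tendsto_eventually)
    qed
  qed (auto simp: indicator_def)
  then have "\<forall>\<^sub>F n in sequentially. (\<integral>\<^sup>+ y\<in>B n. g y \<partial>M) < ennreal (\<epsilon>/2)"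
    using \<open>0 < \<epsilon>\<close> by (intro order_tendstoD(2)) auto
  \<comment> \<open>The index depends on \<open>g\<close>, \<open>q\<close> and \<open>q0\<close>
    but not on \<open>x\<close>, which makes the final estimate uniform.\<close>
  then obtain n where n: "(\<integral>\<^sup>+ y\<in>B n. g y \<partial>M) < ennreal (\<epsilon>/2)"
    using eventually_happens'[OF sequentially_bot] by blast
  define c where "c = real (Suc n)"
  define A where "A = {y\<in>space M. q y \<le> of_nat (Suc n) * q0 y \<and> q y < \<infinity> \<and> q0 y < \<infinity>}"
  \<comment> \<open>The bound of the quotient \<open>q / q0\<close> on \<open>A\<close> is split off
    as \<open>c\<close>, so that multiplication by \<open>m\<close> maps the unit ball into
    itself.\<close>
  define m where "m y = indicator A y * (enn2real (q y) / (c * enn2real (q0 y)))" for y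
  have "0 < c"
    by (simp add: c_def)
  have [measurable]: "A \<in> sets M"
    unfolding A_def by measurable
  have q0_pos: "0 < enn2real (q0 y)" if "y \<in> A" for y
    using that q0(3) by (auto simp: A_def strictly_positive_def enn2real_positive_iff)
  have le: "enn2real (q y) \<le> c * enn2real (q0 y)" if "y \<in> A" for y
  proof -
    have "of_nat (Suc n) * q0 y < top"
      using that by (auto simp: A_def ennreal_mult_less_top of_nat_less_top)
    then have "enn2real (q y) \<le> enn2real (of_nat (Suc n) * q0 y)"
      using that by (intro enn2real_mono) (auto simp: A_def)
    then show ?thesis
      by (simp add: enn2real_mult c_def ennreal_of_nat_eq_real_of_nat del: of_nat_Suc)
  qed
  show thesis
  proof (rule that[of c m])
    show "m \<in> borel_measurable M"
      unfolding m_def by measurable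
    show "\<bar>m y\<bar> \<le> 1" for y
      using mult_pos_pos[OF \<open>0 < c\<close> q0_pos[of y]] le[of y] by (auto simp: m_def indicator_def)
    fix x assume x [measurable]: "x \<in> space M"
    have "AE y in M. ennreal \<bar>weighted_kernel G q x y - c * (m y * weighted_kernel G q0 x y)\<bar>
        \<le> G x y * q y * indicator (B n) y"
      using AE_potential_finite[OF q0(1,2) x] AE_space
    proof eventually_elim
      fix y assume fin: "G x y * q0 y \<noteq> \<infinity>" and y: "y \<in> space M"
      \<comment> \<open>On \<open>A\<close> the two terms cancel; off \<open>A\<close> the
        multiplier \<open>m\<close> is 0. If \<open>q y = \<infinity>\<close>, the kernel of
        \<open>q\<close> is 0 because \<open>enn2real\<close> sends infinity to 0. If
        \<open>q0 y = \<infinity>\<close>, finiteness of \<open>G x y * q0 y\<close> forces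
        \<open>G x y = 0\<close>. Only points of \<open>B n\<close> contribute.\<close>
      consider "y \<in> A" | "y \<notin> A" "q y = \<infinity>" | "y \<notin> A" "q y < \<infinity>" "q0 y = \<infinity>"
        | "y \<notin> A" "y \<in> B n"
        using y by (fastforce simp: A_def B_def not_le less_top)
      then show "ennreal \<bar>weighted_kernel G q x y - c * (m y * weighted_kernel G q0 x y)\<bar>
          \<le> G x y * q y * indicator (B n) y"
      proof cases
        case 1
        then have "weighted_kernel G q x y - c * (m y * weighted_kernel G q0 x y) = 0"
          using q0_pos[OF 1] \<open>0 < c\<close> by (simp add: weighted_kernel_def m_def enn2real_mult)
        then show ?thesis
          by simp
      next
        case 2
        then show ?thesis
          by (simp add: weighted_kernel_def m_def enn2real_mult)
      next
        case 3
        then have "G x y = 0"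
          using fin by (auto simp: ennreal_mult_eq_top_iff)
        then show ?thesis
          by (simp add: weighted_kernel_def)
      next
        case 4
        then show ?thesis
          by (simp add: weighted_kernel_def m_def ennreal_enn2real_if)
      qed
    qed
    then have "(\<integral>\<^sup>+ y. ennreal \<bar>weighted_kernel G q x y - c * (m y * weighted_kernel G q0 x y)\<bar> \<partial>M)
        \<le> (\<integral>\<^sup>+ y\<in>B n. G x y * q y \<partial>M)"
      by (rule nn_integral_mono_AE)
    also have "\<dots> \<le> ennreal (\<epsilon>/2) + (\<integral>\<^sup>+ y\<in>B n. g y \<partial>M)"
      by (rule gq) (use x in measurable)
    also have "\<dots> \<le> ennreal (\<epsilon>/2) + ennreal (\<epsilon>/2)"
      using n by (intro add_left_mono) simp
    also have "\<dots> = ennreal \<epsilon>"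
      using \<open>0 < \<epsilon>\<close> by (simp flip: ennreal_plus)
    finally show "(\<integral>\<^sup>+ y. ennreal \<bar>weighted_kernel G q x y - c * (m y * weighted_kernel G q0 x y)\<bar> \<partial>M)
        \<le> ennreal \<epsilon>" .
  qed fact
qed

text \<open>With \<open>h\<close> the product of \<open>m\<close> and \<open>f\<close>, the
  difference of the operators is the integral of \<open>f\<close> against the kernel error, at most
  \<open>C\<close> times its integral norm. The factor \<open>c\<close> is chosen before
  \<open>f\<close>, as total boundedness requires; \<open>C\<close> stays arbitrary to cover single
  functions as well as the unit ball.\<close>

lemma ex_K_op_approx:
  fixes \<epsilon> :: real
  assumes q0: "q0 \<in> borel_measurable M" "bounded_potential M G q0" "strictly_positive M q0"
    and q: "q \<in> F_ui M G" and "0 < \<epsilon>"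
  shows "\<exists>c>0. \<forall>f\<in>mspace (Eb M). \<forall>C. (\<forall>x\<in>space M. \<bar>f x\<bar> \<le> C) \<longrightarrow>
    (\<exists>h\<in>mspace (Eb M). \<forall>x\<in>space M.
      \<bar>h x\<bar> \<le> C \<and> \<bar>K_op M G q f x - c * K_op M G q0 h x\<bar> \<le> C * \<epsilon>)"
proof -
  obtain c :: real and m where cm: "0 < c" "m \<in> borel_measurable M" "\<And>y. \<bar>m y\<bar> \<le> 1"
    and kernel_approx: "\<And>x. x \<in> space M \<Longrightarrow>
      (\<integral>\<^sup>+ y. ennreal \<bar>weighted_kernel G q x y - c * (m y * weighted_kernel G q0 x y)\<bar> \<partial>M)
        \<le> ennreal \<epsilon>"
    using ex_weighted_kernel_approx[OF q0 q \<open>0 < \<epsilon>\<close>] by blast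
  have qm: "q \<in> borel_measurable M" "bounded_potential M G q"
    using q F_ui_imp_measurable F_ui_imp_bounded_potential by auto
  show ?thesis
  proof (intro exI[of _ c] conjI ballI allI impI)
    show "0 < c"
      by fact
    fix f C assume f: "f \<in> mspace (Eb M)" and "\<forall>x\<in>space M. \<bar>f x\<bar> \<le> C"
    then have C: "\<bar>f x\<bar> \<le> C" if "x \<in> space M" for x
      using that by blast
    define h where "h = (\<lambda>x\<in>space M. m x * f x)"
    have h: "h \<in> mspace (Eb M)"
      unfolding h_def using f cm(2,3) by (rule mspace_Eb_mult)
    have "\<bar>h x\<bar> \<le> C" if "x \<in> space M" for x
      using mult_mono[OF cm(3) C[OF that]] that by (simp add: h_def abs_mult)
    moreover have "\<bar>K_op M G q f x - c * K_op M G q0 h x\<bar> \<le> C * \<epsilon>" if x: "x \<in> space M" for x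
    proof -
      let ?k = "weighted_kernel G q x" and ?l = "weighted_kernel G q0 x"
      let ?D = "\<lambda>y. ?k y - c * (m y * ?l y)"
      \<comment> \<open>The given point \<open>x\<close> shows that the space is nonempty, so the
        bound on \<open>f\<close> forces the sign of \<open>C\<close>.\<close>
      have "0 \<le> C"
        using C[OF x] by linarith
      note int = integrable_mult_weighted_kernel[OF qm f x]
        integrable_mult_weighted_kernel[OF q0(1,2) h x]
      have D: "?D \<in> borel_measurable M"
        using integrable_weighted_kernel[OF qm x] integrable_weighted_kernel[OF q0(1,2) x] cm(2)
        by measurable
      have "K_op M G q f x - c * K_op M G q0 h x = (\<integral>y. f y * ?k y - c * (h y * ?l y) \<partial>M)"
        using int by (simp add: K_op_eq_integral[OF qm f x] K_op_eq_integral[OF q0(1,2) h x])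
      then have "ennreal \<bar>K_op M G q f x - c * K_op M G q0 h x\<bar>
          = ennreal \<bar>\<integral>y. f y * ?k y - c * (h y * ?l y) \<partial>M\<bar>"
        by simp
      also have "ennreal \<bar>\<integral>y. f y * ?k y - c * (h y * ?l y) \<partial>M\<bar>
          \<le> (\<integral>\<^sup>+ y. ennreal \<bar>f y * ?k y - c * (h y * ?l y)\<bar> \<partial>M)"
        using integral_norm_bound_ennreal[of M "\<lambda>y. f y * ?k y - c * (h y * ?l y)"] int by simp
      also have "\<dots> \<le> (\<integral>\<^sup>+ y. ennreal C * ennreal \<bar>?D y\<bar> \<partial>M)"
      proof (rule nn_integral_mono)
        fix y assume y: "y \<in> space M"
        have "f y * ?k y - c * (h y * ?l y) = f y * ?D y"
          using y by (simp add: h_def algebra_simps)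
        then have "\<bar>f y * ?k y - c * (h y * ?l y)\<bar> \<le> C * \<bar>?D y\<bar>"
          using C[OF y] by (simp add: abs_mult mult_right_mono)
        then show "ennreal \<bar>f y * ?k y - c * (h y * ?l y)\<bar> \<le> ennreal C * ennreal \<bar>?D y\<bar>"
          using \<open>0 \<le> C\<close> by (simp flip: ennreal_mult)
      qed
      also have "\<dots> = ennreal C * (\<integral>\<^sup>+ y. ennreal \<bar>?D y\<bar> \<partial>M)"
        using D by (intro nn_integral_cmult) auto
      also have "\<dots> \<le> ennreal C * ennreal \<epsilon>"
        using kernel_approx[OF x] by (intro mult_left_mono) auto
      finally have "ennreal \<bar>K_op M G q f x - c * K_op M G q0 h x\<bar> \<le> ennreal C * ennreal \<epsilon>" .
      then show ?thesis
        using \<open>0 \<le> C\<close> \<open>0 < \<epsilon>\<close> by (simp flip: ennreal_mult)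
    qed
    ultimately show "\<exists>h\<in>mspace (Eb M). \<forall>x\<in>space M.
        \<bar>h x\<bar> \<le> C \<and> \<bar>K_op M G q f x - c * K_op M G q0 h x\<bar> \<le> C * \<epsilon>"
      using h by blast
  qed
qed

end

section \<open>Compactness of the operator\<close>

theorem theorem2p1:
  fixes M :: "'a measure" and G :: "'a \<Rightarrow> 'a \<Rightarrow> ennreal"
  assumes "(\<lambda>(x, y). G x y) \<in> borel_measurable (M \<Otimes>\<^sub>M M)"
    and "\<exists>q\<in>F_co M G. strictly_positive M q"
  shows "F_ui M G \<subseteq> F_co M G"
proof
  interpret E: Metric_space "mspace (Eb M)" "mdist (Eb M)"
    by (rule Metric_space_mspace_mdist)
  let ?z = "\<lambda>x\<in>space M. 0 :: real"
  have z: "?z \<in> mspace (Eb M)"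
    by (rule mspace_EbI[of _ _ 0]) auto
  have ball_iff: "f \<in> mcball_of (Eb M) ?z 1 \<longleftrightarrow>
      f \<in> mspace (Eb M) \<and> (\<forall>x\<in>space M. \<bar>f x\<bar> \<le> 1)" for f
  proof
    assume "f \<in> mcball_of (Eb M) ?z 1"
    then show "f \<in> mspace (Eb M) \<and> (\<forall>x\<in>space M. \<bar>f x\<bar> \<le> 1)"
      using abs_diff_le_mdist_Eb[OF z, of f] by fastforce
  next
    assume "f \<in> mspace (Eb M) \<and> (\<forall>x\<in>space M. \<bar>f x\<bar> \<le> 1)"
    then show "f \<in> mcball_of (Eb M) ?z 1"
      using z by (auto intro!: mdist_Eb_le)
  qed
  fix q assume q: "q \<in> F_ui M G"
  have qm: "q \<in> borel_measurable M"
    using q by (rule F_ui_imp_measurable)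
  have bp: "bounded_potential M G q"
    using assms(1) q by (rule F_ui_imp_bounded_potential)
  obtain q0 where "q0 \<in> F_co M G" and "strictly_positive M q0"
    using assms(2) by blast
  then have q0: "q0 \<in> borel_measurable M" "bounded_potential M G q0" "strictly_positive M q0"
    and K0: "K_op M G q0 ` mspace (Eb M) \<subseteq> mspace (Eb M)"
    and tb0: "E.mtotally_bounded (K_op M G q0 ` mcball_of (Eb M) ?z 1)"
    unfolding F_co_iff_mtotally_bounded by blast+
  note approx = ex_K_op_approx[OF assms(1) q0 q]
  have K: "K_op M G q f \<in> mspace (Eb M)" if f: "f \<in> mspace (Eb M)" for f
  proof (rule mspace_Eb_uniform_limit)
    show "K_op M G q f \<in> extensional (space M)"
      by (simp add: K_op_def)
    fix \<epsilon> :: real assume "0 < \<epsilon>"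
    obtain C where "0 \<le> C" and C: "\<And>x. x \<in> space M \<Longrightarrow> \<bar>f x\<bar> \<le> C"
      using mspace_EbE[OF f] by blast
    \<comment> \<open>The denominator is \<open>C + 1\<close> because \<open>C\<close> may be 0; the
      resulting error \<open>C * (\<epsilon> / (C + 1))\<close> is still at most \<epsilon>.\<close>
    have "0 < \<epsilon> / (C + 1)"
      using \<open>0 < \<epsilon>\<close> \<open>0 \<le> C\<close> by simp
    then obtain c h where h: "h \<in> mspace (Eb M)"
      "\<forall>x\<in>space M. \<bar>K_op M G q f x - c * K_op M G q0 h x\<bar> \<le> C * (\<epsilon> / (C + 1))"
      using approx[of "\<epsilon> / (C + 1)"] f C by blast
    have "C * (\<epsilon> / (C + 1)) \<le> \<epsilon>"
      using \<open>0 < \<epsilon>\<close> \<open>0 \<le> C\<close> by (simp add: field_simps)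
    with h(2) have "\<forall>x\<in>space M. \<bar>K_op M G q f x - (\<lambda>x\<in>space M. c * K_op M G q0 h x) x\<bar> \<le> \<epsilon>"
      by fastforce
    moreover have "(\<lambda>x\<in>space M. c * K_op M G q0 h x) \<in> mspace (Eb M)"
      using K0 h(1) by (intro mspace_Eb_scale) auto
    ultimately show "\<exists>g\<in>mspace (Eb M). \<forall>x\<in>space M. \<bar>K_op M G q f x - g x\<bar> \<le> \<epsilon>"
      by blast
  qed
  have "E.mtotally_bounded (K_op M G q ` mcball_of (Eb M) ?z 1)"
  proof (rule E.mtotally_bounded_approx)
    show "K_op M G q ` mcball_of (Eb M) ?z 1 \<subseteq> mspace (Eb M)"
      using K by auto
    fix \<epsilon> :: real assume "0 < \<epsilon>"
    then obtain c where c: "0 < c" and ch: "\<And>f. f \<in> mspace (Eb M) \<Longrightarrow> \<forall>x\<in>space M. \<bar>f x\<bar> \<le> 1 \<Longrightarrow>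
      \<exists>h\<in>mspace (Eb M). \<forall>x\<in>space M.
        \<bar>h x\<bar> \<le> 1 \<and> \<bar>K_op M G q f x - c * K_op M G q0 h x\<bar> \<le> 1 * \<epsilon>"
      using approx[of \<epsilon>] by blast
    \<comment> \<open>Since \<open>c\<close> is the same for all \<open>f\<close> and each
      \<open>h\<close> stays in the unit ball, this one set contains every approximant.\<close>
    let ?T = "(\<lambda>f. \<lambda>x\<in>space M. c * f x) ` K_op M G q0 ` mcball_of (Eb M) ?z 1"
    have "E.mtotally_bounded ?T"
      using mtotally_bounded_Eb_scale[OF tb0] c by simp
    moreover have "\<exists>t\<in>?T. mdist (Eb M) (K_op M G q f) t \<le> \<epsilon>"
      if "f \<in> mcball_of (Eb M) ?z 1" for f
    proof -
      have f: "f \<in> mspace (Eb M)" "\<forall>x\<in>space M. \<bar>f x\<bar> \<le> 1"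
        using that unfolding ball_iff by auto
      obtain h where h: "h \<in> mspace (Eb M)" "\<forall>x\<in>space M. \<bar>h x\<bar> \<le> 1"
        "\<forall>x\<in>space M. \<bar>K_op M G q f x - c * K_op M G q0 h x\<bar> \<le> \<epsilon>"
        using ch[OF f] by auto
      let ?t = "\<lambda>x\<in>space M. c * K_op M G q0 h x"
      have "?t \<in> mspace (Eb M)"
        using K0 h(1) by (intro mspace_Eb_scale) auto
      then have "mdist (Eb M) (K_op M G q f) ?t \<le> \<epsilon>"
        using h(3) K[OF f(1)] \<open>0 < \<epsilon>\<close> by (intro mdist_Eb_le) auto
      moreover have "?t \<in> ?T"
        using h(1,2) ball_iff by blast
      ultimately show ?thesis
        by blast
    qed
    ultimately show "\<exists>T. E.mtotally_bounded T \<and>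
        (\<forall>s\<in>K_op M G q ` mcball_of (Eb M) ?z 1. \<exists>t\<in>T. mdist (Eb M) s t \<le> \<epsilon>)"
      by blast
  qed
  moreover have "K_op M G q ` mspace (Eb M) \<subseteq> mspace (Eb M)"
    using K by (rule image_subsetI)
  ultimately show "q \<in> F_co M G"
    unfolding F_co_iff_mtotally_bounded
    by (intro conjI qm bp linear_on_Eb_K_op[OF assms(1) qm bp])
qed

end
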